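(* Let $k$ be a field and $X,Y,Z$ indeterminates over $k$. Set $D_1=k(X)[Y]_{(Y)}$, $D_2=k(Y)[X]_{(X)}$ (both viewed as subrings of $k(X,Y)$), $D=D_1\cap D_2$, $V=k(X,Y)[[Z]]=k(X,Y)+M$ with $M=ZV$ its maximal ideal, $R=D+M$, $A=Z(D_1+M)$ and $B=Z(D_2+M)$. Then $R$ is a Prüfer domain, $A^{-1}=B^{-1}=V$, $A_v=B_v=M$ (so $A_v\cap B_v=M$), and $A\cap B=ZR$, so that $(A\cap B)_v=ZR\subsetneq M=A_v\cap B_v$. In particular, the $v$-operation on the Prüfer domain $R$ is not stable.
   Context: For an integral domain $R$ with quotient field $L$ and a nonzero fractional ideal $E$ of $R$, $E^{-1}=(R:E)=\{x\in L: xE\subseteq R\}$ and $E_v=(E^{-1})^{-1}$; the map $E\mapsto E_v$ is the $v$-operation on $R$. A star operation $*$ on $R$ is stable if $(A\cap B)^*=A^*\cap B^*$ for all nonzero fractional ideals $A,B$ of $R$. *)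

theory Defs
  imports
    "HOL-Computational_Algebra.Computational_Algebra"
    "HOL-Library.Set_Algebras"
begin

text \<open>
  Integral domains are rendered as subrings \<open>R\<close> of an ambient field, so that intersections of
  overrings and of fractional ideals are plain set intersections. The quotient field \<open>L\<close> of \<open>R\<close>
  is the subfield \<open>quot_field R\<close> of the ambient field; it need not be all of it.
\<close>

definition subring_of_field :: "'a::field set \<Rightarrow> bool" where
  "subring_of_field R \<longleftrightarrow>
     0 \<in> R \<and> 1 \<in> R \<and> (\<forall>x\<in>R. \<forall>y\<in>R. x - y \<in> R \<and> x * y \<in> R)"

definition quot_field :: "'a::field set \<Rightarrow> 'a set" where
  "quot_field R = {a / b | a b. a \<in> R \<and> b \<in> R \<and> b \<noteq> 0}"

definition submodule_of_field :: "'a::field set \<Rightarrow> 'a set \<Rightarrow> bool" where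
  "submodule_of_field R E \<longleftrightarrow>
     0 \<in> E \<and> (\<forall>x\<in>E. \<forall>y\<in>E. x + y \<in> E) \<and> (\<forall>r\<in>R. \<forall>x\<in>E. r * x \<in> E)"

definition ideal_of :: "'a::field set \<Rightarrow> 'a set \<Rightarrow> bool" where
  "ideal_of R I \<longleftrightarrow> submodule_of_field R I \<and> I \<subseteq> R"

definition maximal_ideal_of :: "'a::field set \<Rightarrow> 'a set \<Rightarrow> bool" where
  "maximal_ideal_of R I \<longleftrightarrow>
     ideal_of R I \<and> I \<noteq> R \<and> (\<forall>J. ideal_of R J \<and> I \<subseteq> J \<longrightarrow> J = I \<or> J = R)"

definition fractional_ideal :: "'a::field set \<Rightarrow> 'a set \<Rightarrow> bool" where
  "fractional_ideal R E \<longleftrightarrow>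
     submodule_of_field R E \<and> E \<subseteq> quot_field R \<and> (\<exists>d\<in>R. d \<noteq> 0 \<and> d *o E \<subseteq> R)"

definition nonzero_fractional_ideal :: "'a::field set \<Rightarrow> 'a set \<Rightarrow> bool" where
  "nonzero_fractional_ideal R E \<longleftrightarrow> fractional_ideal R E \<and> E \<noteq> {0}"

definition frac_inv :: "'a::field set \<Rightarrow> 'a set \<Rightarrow> 'a set" where
  "frac_inv R E = {x \<in> quot_field R. x *o E \<subseteq> R}"

definition v_op :: "'a::field set \<Rightarrow> 'a set \<Rightarrow> 'a set" where
  "v_op R E = frac_inv R (frac_inv R E)"

text \<open>
  A star operation is represented by a map on all subsets of the ambient field, of which only the
  values at nonzero fractional ideals matter.
\<close>

definition stable_op :: "'a::field set \<Rightarrow> ('a set \<Rightarrow> 'a set) \<Rightarrow> bool" where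
  "stable_op R star \<longleftrightarrow>
     (\<forall>A B. nonzero_fractional_ideal R A \<longrightarrow> nonzero_fractional_ideal R B \<longrightarrow>
        star (A \<inter> B) = star A \<inter> star B)"

text \<open>
  In \<open>Set_Algebras\<close>, \<open>E * F\<close> is only the set of elementwise products; the product of
  fractional ideals is the submodule it generates.
\<close>

definition frac_mult :: "'a::field set \<Rightarrow> 'a set \<Rightarrow> 'a set \<Rightarrow> 'a set" where
  "frac_mult R E F = submodule_of_field R hull (E * F)"

definition invertible_frac :: "'a::field set \<Rightarrow> 'a set \<Rightarrow> bool" where
  "invertible_frac R E \<longleftrightarrow> frac_mult R E (frac_inv R E) = R"

text \<open>Every nonzero finitely generated ideal is invertible.\<close>

definition pruefer_domain :: "'a::field set \<Rightarrow> bool" where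
  "pruefer_domain R \<longleftrightarrow> subring_of_field R \<and>
     (\<forall>S. finite S \<and> S \<subseteq> R \<and> submodule_of_field R hull S \<noteq> {0} \<longrightarrow>
        invertible_frac R (submodule_of_field R hull S))"

text \<open>\<open>S[t]\<close> for a subring \<open>S\<close>, and the localization of \<open>S\<close> at a prime ideal \<open>P\<close>.\<close>

definition adjoin :: "'a::field set \<Rightarrow> 'a \<Rightarrow> 'a set" where
  "adjoin S t = {poly p t | p. \<forall>i. coeff p i \<in> S}"

definition localize :: "'a::field set \<Rightarrow> 'a set \<Rightarrow> 'a set" where
  "localize S P = {a / b | a b. a \<in> S \<and> b \<in> S - P}"

text \<open>\<open>k(X,Y)\<close> is the fraction field of \<open>k[X][Y]\<close>: the inner variable is \<open>X\<close>, the outer one \<open>Y\<close>.\<close>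

type_synonym 'k rat_fun2 = "'k poly poly fract"

definition base_field :: "'k::field rat_fun2 set" where
  "base_field = range (\<lambda>c. to_fract [:[:c:]:])"

definition indet_X :: "'k::field rat_fun2" where
  "indet_X = to_fract [:[:0, 1:]:]"

definition indet_Y :: "'k::field rat_fun2" where
  "indet_Y = to_fract [:0, 1:]"

text \<open>
  For indeterminates \<open>s\<close>, \<open>t\<close>, the ring \<open>k(s)[t]\<close> and its localization at the ideal generated by \<open>t\<close>,
  inside \<open>k(X,Y)\<close>.
\<close>

definition poly_over_rat_fun :: "'k::field rat_fun2 \<Rightarrow> 'k rat_fun2 \<Rightarrow> 'k rat_fun2 set" where
  "poly_over_rat_fun s t = adjoin (quot_field (adjoin base_field s)) t"

definition local_poly_ring :: "'k::field rat_fun2 \<Rightarrow> 'k rat_fun2 \<Rightarrow> 'k rat_fun2 set" where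
  "local_poly_ring s t = localize (poly_over_rat_fun s t) (t *o poly_over_rat_fun s t)"

end

theory Submission
  imports Defs
begin

text \<open>
  Both \<open>D1\<close> and \<open>D2\<close> are discrete valuation rings of \<open>K = k(X,Y)\<close>, with uniformizers \<open>Y\<close> and
  \<open>X\<close>, and each contains the inverse of the other's uniformizer. The whole example uses
  only these facts. An element of \<open>V\<close> lies in \<open>M\<close>, \<open>R\<close>, \<open>D1 + M\<close> or \<open>D2 + M\<close> exactly when its
  constant term lies in \<open>0\<close>, \<open>D\<close>, \<open>D1\<close> or \<open>D2\<close>, so questions about \<open>R\<close> become questions about
  constant terms.

  For the failure of stability, suppose that \<open>x A \<subseteq> R\<close> and let \<open>d\<close> be the constant term of \<open>x Z\<close>.
  Then \<open>d D1 \<subseteq> D2\<close>. As \<open>D1\<close> contains \<open>1 / X\<^sup>n\<close> for all \<open>n\<close>, \<open>d\<close> is divisible in \<open>D2\<close> by all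
  powers of its uniformizer, so \<open>d = 0\<close> and \<open>x \<in> V\<close> (\<open>annihilator_D1\<close>, \<open>frac_inv_A\<close>). Thus
  \<open>A\<close> has inverse \<open>V\<close>, whose inverse in turn is \<open>M\<close> by the same argument (\<open>frac_inv_V\<close>); by symmetry
  the same holds for \<open>B\<close>. But \<open>A \<inter> B = Z (D1 \<inter> D2 + M) = Z R\<close> is principal, hence equal to
  its \<open>v\<close>-closure, and it is smaller than \<open>M\<close> because \<open>D \<noteq> K\<close>.

  That \<open>R\<close> is a Pruefer domain is obtained in the stronger form that \<open>R\<close> is a Bezout domain: each
  finitely generated ideal is principal, and nonzero principal ideals are invertible
  (\<open>bezout_pruefer\<close>). For \<open>D\<close> a generator of \<open>c D + D\<close> can be found among \<open>1\<close>, \<open>c\<close> and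
  \<open>1 + c\<close>, and this works for the intersection of any two valuation rings of a field
  (\<open>bezout_Int_valuation_rings\<close>). The property passes from \<open>D\<close> to \<open>R\<close> (\<open>bezout_series_over\<close>).
\<close>

section \<open>Subrings of a field\<close>

lemma subring_closed:
  assumes "subring_of_field R"
  shows "0 \<in> R" "1 \<in> R" "x \<in> R \<Longrightarrow> y \<in> R \<Longrightarrow> x - y \<in> R" "x \<in> R \<Longrightarrow> y \<in> R \<Longrightarrow> x * y \<in> R"
    "x \<in> R \<Longrightarrow> - x \<in> R" "x \<in> R \<Longrightarrow> y \<in> R \<Longrightarrow> x + y \<in> R"
proof -
  show *: "0 \<in> R" "1 \<in> R" "\<And>x y. x \<in> R \<Longrightarrow> y \<in> R \<Longrightarrow> x - y \<in> R"
    "x \<in> R \<Longrightarrow> y \<in> R \<Longrightarrow> x * y \<in> R"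
    using assms by (auto simp: subring_of_field_def)
  show neg: "- x \<in> R" if "x \<in> R" for x
    using *(3)[OF *(1) that] by simp
  show "x \<in> R \<Longrightarrow> y \<in> R \<Longrightarrow> x + y \<in> R"
    using *(3)[OF _ neg, of x y] by simp
qed

lemma subring_sum:
  assumes "subring_of_field R" "\<And>i. i \<in> I \<Longrightarrow> f i \<in> R"
  shows "sum f I \<in> R"
  using assms(2) by (induction I rule: infinite_finite_induct)
    (auto intro: subring_closed[OF assms(1)])

lemma subring_power:
  assumes "subring_of_field R" "x \<in> R"
  shows "x ^ n \<in> R"
  by (induction n) (auto intro: subring_closed[OF assms(1)] assms(2))

lemma subring_Int:
  "subring_of_field R \<Longrightarrow> subring_of_field S \<Longrightarrow> subring_of_field (R \<inter> S)"
  by (auto simp: subring_of_field_def)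

lemma mem_elt_times_iff: "x \<in> c *o S \<longleftrightarrow> (\<exists>s\<in>S. x = c * s)"
  by (simp add: elt_set_times_def)

lemma elt_times_Int:
  fixes c :: "'a::field"
  assumes "c \<noteq> 0"
  shows "c *o S \<inter> c *o T = c *o (S \<inter> T)"
  using assms by (auto simp: mem_elt_times_iff)

lemma submodule_principal:
  assumes "subring_of_field R"
  shows "submodule_of_field R (c *o R)"
  unfolding submodule_of_field_def
proof (intro conjI ballI)
  show "0 \<in> c *o R"
    using subring_closed[OF assms] by (auto simp: mem_elt_times_iff intro: bexI[of _ 0])
next
  fix x y assume "x \<in> c *o R" "y \<in> c *o R"
  then show "x + y \<in> c *o R"
    using subring_closed[OF assms] by (auto simp: mem_elt_times_iff simp flip: distrib_left)
next
  fix r x assume "r \<in> R" "x \<in> c *o R"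
  then show "r * x \<in> c *o R"
    using subring_closed[OF assms] by (auto simp: mem_elt_times_iff mult.left_commute)
qed

lemma frac_inv_principal:
  assumes R: "subring_of_field R" and quot: "quot_field R = UNIV" and c: "c \<noteq> 0"
  shows "frac_inv R (c *o R) = inverse c *o R"
proof (intro equalityI subsetI)
  fix x assume "x \<in> frac_inv R (c *o R)"
  then have "x * (c * 1) \<in> R"
    using subring_closed(2)[OF R] unfolding frac_inv_def by blast
  then show "x \<in> inverse c *o R"
    using c by (auto simp: mem_elt_times_iff intro!: bexI[of _ "x * c"])
next
  fix x assume "x \<in> inverse c *o R"
  then obtain s where s: "s \<in> R" "x = inverse c * s"
    by (auto simp: mem_elt_times_iff)
  have "x * (c * r) \<in> R" if "r \<in> R" for r
  proof -
    have "x * (c * r) = s * r" using c s(2) by simp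
    then show ?thesis using subring_closed(4)[OF R s(1) that] by metis
  qed
  then show "x \<in> frac_inv R (c *o R)"
    using quot by (auto simp: frac_inv_def mem_elt_times_iff)
qed

lemma v_op_principal:
  assumes R: "subring_of_field R" and quot: "quot_field R = UNIV" and c: "c \<noteq> 0"
  shows "v_op R (c *o R) = c *o R"
  using c by (simp add: v_op_def frac_inv_principal[OF R quot])

section \<open>Bezout subrings\<close>

text \<open>
  The condition says that \<open>x R + R = h R\<close>: every fractional ideal with two generators, normalised
  so that one of them is \<open>1\<close>, is principal. As \<open>x = (x / h) / (1 / h)\<close>, it also forces the quotient
  field of \<open>R\<close> to be the whole ambient field.
\<close>

definition bezout_in_field :: "'a::field set \<Rightarrow> bool" where
  "bezout_in_field R \<longleftrightarrow>
     (\<forall>x. \<exists>h p q. h \<noteq> 0 \<and> x / h \<in> R \<and> 1 / h \<in> R \<and> p \<in> R \<and> q \<in> R \<and> h = p * x + q)"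

lemma bezout_quot_field:
  assumes "bezout_in_field R"
  shows "quot_field R = UNIV"
proof -
  have "x \<in> quot_field R" for x
  proof -
    obtain h where "h \<noteq> 0" "x / h \<in> R" "1 / h \<in> R"
      using assms unfolding bezout_in_field_def by metis
    then have "x = (x / h) / (1 / h)" "1 / h \<noteq> 0"
      by simp_all
    then show ?thesis
      using \<open>x / h \<in> R\<close> \<open>1 / h \<in> R\<close> unfolding quot_field_def by blast
  qed
  then show ?thesis by blast
qed

lemma bezout_hull_principal:
  assumes R: "subring_of_field R" and bez: "bezout_in_field R" and "finite S"
  shows "\<exists>c. submodule_of_field R hull S = c *o R"
  using \<open>finite S\<close>
proof (induction S)
  case empty
  have "submodule_of_field R hull {} = 0 *o R"
    by (rule hull_unique) (auto simp: submodule_principal[OF R], auto simp: mem_elt_times_iff submodule_of_field_def)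
  then show ?case ..
next
  case (insert x S)
  then obtain c where c: "submodule_of_field R hull S = c *o R"
    by blast
  then have S: "S \<subseteq> c *o R"
    using hull_subset[of S "submodule_of_field R"] by simp
  have "c \<in> submodule_of_field R hull S"
    unfolding c using subring_closed(2)[OF R] by (auto simp: mem_elt_times_iff intro: bexI[of _ 1])
  then have cT: "c \<in> T" if "S \<subseteq> T" "submodule_of_field R T" for T
    using hull_minimal[of S T, OF that(1)] that(2) by blast
  show ?case
  proof (cases "c = 0")
    case True
    have "submodule_of_field R hull (insert x S) = x *o R"
    proof (rule hull_unique)
      show "insert x S \<subseteq> x *o R"
        using S True subring_closed(1,2)[OF R]
        by (force simp: mem_elt_times_iff intro: bexI[of _ 1] bexI[of _ 0])
    next
      fix T assume "insert x S \<subseteq> T" "submodule_of_field R T"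
      then show "x *o R \<subseteq> T"
        by (auto simp: mem_elt_times_iff submodule_of_field_def mult.commute[of x])
    qed (rule submodule_principal[OF R])
    then show ?thesis ..
  next
    case False
    obtain h p q where h: "h \<noteq> 0" "(x / c) / h \<in> R" "1 / h \<in> R" "p \<in> R" "q \<in> R"
      "h = p * (x / c) + q"
      using bez unfolding bezout_in_field_def by metis
    have "submodule_of_field R hull (insert x S) = (c * h) *o R"
    proof (rule hull_unique)
      have "c * r = c * h * ((1 / h) * r)" for r
        using h(1) by simp
      then have "c * r \<in> (c * h) *o R" if "r \<in> R" for r
        using that h(3) subring_closed(4)[OF R] unfolding mem_elt_times_iff by metis
      then have "S \<subseteq> (c * h) *o R"
        using S unfolding elt_set_times_def by blast
      moreover have "x = c * h * (x / c / h)"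
        using False h(1) by simp
      ultimately show "insert x S \<subseteq> (c * h) *o R"
        using h(2) unfolding insert_subset mem_elt_times_iff by blast
    next
      fix T assume T: "insert x S \<subseteq> T" "submodule_of_field R T"
      have "c * h = p * x + q * c"
        using False by (subst h(6)) (simp add: algebra_simps)
      then have "c * h \<in> T"
        using cT[of T] T h(4,5) by (auto simp: submodule_of_field_def)
      then show "(c * h) *o R \<subseteq> T"
        using T(2) by (auto simp: mem_elt_times_iff submodule_of_field_def mult.commute[of "c * h"])
    qed (rule submodule_principal[OF R])
    then show ?thesis ..
  qed
qed

lemma bezout_pruefer:
  assumes R: "subring_of_field R" and bez: "bezout_in_field R"
  shows "pruefer_domain R"
  unfolding pruefer_domain_def
proof (intro conjI allI impI R)
  fix S assume S: "finite S \<and> S \<subseteq> R \<and> submodule_of_field R hull S \<noteq> {0}"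
  obtain c where c: "submodule_of_field R hull S = c *o R"
    using bezout_hull_principal[OF R bez] S by blast
  have "c \<noteq> 0"
    using S c subring_closed(1)[OF R] by (auto simp: mem_elt_times_iff)
  have "submodule_of_field R hull ((c *o R) * (inverse c *o R)) = R"
  proof (rule hull_same[THEN trans])
    have "(c *o R) * (inverse c *o R) = 1 *o (R * R)"
      using \<open>c \<noteq> 0\<close> by (simp add: set_times_rearrange)
    also have "R * R = R"
    proof (intro equalityI subsetI)
      fix x assume "x \<in> R"
      then have "x * 1 \<in> R * R" using subring_closed(2)[OF R] by (rule set_times_intro)
      then show "x \<in> R * R" by simp
    qed (auto elim!: set_times_elim intro: subring_closed[OF R])
    finally show *: "(c *o R) * (inverse c *o R) = R" by simp
    show "submodule_of_field R ((c *o R) * (inverse c *o R))"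
      using submodule_principal[OF R, of 1] * by simp
  qed
  then show "invertible_frac R (submodule_of_field R hull S)"
    by (simp add: invertible_frac_def frac_mult_def c frac_inv_principal[OF R bezout_quot_field[OF bez] \<open>c \<noteq> 0\<close>])
qed

text \<open>
  Let \<open>v\<^sub>1\<close>, \<open>v\<^sub>2\<close> be the valuations. A generator \<open>h\<close> of \<open>c D + D\<close> must satisfy
  \<open>v\<^sub>i h = min (v\<^sub>i c) 0\<close> for both \<open>i\<close>. If \<open>v\<^sub>1 c\<close> and \<open>v\<^sub>2 c\<close> do not have strictly opposite signs,
  then \<open>1\<close> or \<open>c\<close> does this; otherwise neither of them vanishes, and \<open>1 + c\<close> does.
\<close>

lemma bezout_Int_valuation_rings:
  assumes D: "subring_of_field D1" "subring_of_field D2"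
    and val: "\<And>c. c \<in> D1 \<or> inverse c \<in> D1" "\<And>c. c \<in> D2 \<or> inverse c \<in> D2"
  shows "bezout_in_field (D1 \<inter> D2)"
proof -
  have unit: "c \<noteq> -1 \<and> 1 / (1 + c) \<in> E \<and> c / (1 + c) \<in> E"
    if E: "subring_of_field E" and v: "\<And>c. c \<in> E \<or> inverse c \<in> E"
      and c: "inverse c \<notin> E" for E and c :: 'a
  proof -
    note cl = subring_closed[OF E]
    have c1: "c \<noteq> -1" "c \<noteq> 0"
      using c cl(1) cl(5)[OF cl(2)] by auto
    then have "1 + c \<noteq> 0"
      by (metis add_eq_0_iff)
    have "c / (1 + c) \<in> E"
    proof (rule ccontr)
      assume "c / (1 + c) \<notin> E"
      then have "inverse (c / (1 + c)) \<in> E" using v by blast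
      then have "inverse (c / (1 + c)) - 1 \<in> E" using cl by blast
      also have "inverse (c / (1 + c)) - 1 = inverse c"
        using c1 \<open>1 + c \<noteq> 0\<close> by (simp add: field_simps)
      finally show False using c by blast
    qed
    moreover have "1 / (1 + c) = 1 - c / (1 + c)"
      using \<open>1 + c \<noteq> 0\<close> by (simp add: field_simps)
    ultimately show ?thesis using cl c1 by metis
  qed
  have flip: "1 / (1 + c) = inverse c / (1 + inverse c)" "c / (1 + c) = 1 / (1 + inverse c)"
    if "c \<noteq> 0" "c \<noteq> -1" for c :: 'a
  proof -
    have "1 + c \<noteq> 0" using that by (metis add_eq_0_iff)
    then show "1 / (1 + c) = inverse c / (1 + inverse c)" "c / (1 + c) = 1 / (1 + inverse c)"
      using that by (simp_all add: field_simps)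
  qed
  have opposite: "1 / (1 + c) \<in> E1 \<inter> E2 \<and> c / (1 + c) \<in> E1 \<inter> E2 \<and> 1 + c \<noteq> 0"
    if E: "subring_of_field E1" "subring_of_field E2"
      and v: "\<And>c. c \<in> E1 \<or> inverse c \<in> E1" "\<And>c. c \<in> E2 \<or> inverse c \<in> E2"
      and c: "inverse c \<notin> E1" "c \<notin> E2" for E1 E2 and c :: 'a
  proof -
    have 1: "c \<noteq> -1" "1 / (1 + c) \<in> E1" "c / (1 + c) \<in> E1"
      using unit[OF E(1) v(1) c(1)] by auto
    have 2: "1 / (1 + inverse c) \<in> E2" "inverse c / (1 + inverse c) \<in> E2"
      using unit[OF E(2) v(2), of "inverse c"] c(2) by auto
    have "c \<noteq> 0" using c(2) subring_closed(1)[OF E(2)] by auto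
    then show ?thesis
      using 1 2 flip[of c] by (metis IntI add_eq_0_iff)
  qed
  note cl = subring_closed[OF subring_Int[OF D]]
  have "\<exists>h p q. h \<noteq> 0 \<and> c / h \<in> D1 \<inter> D2 \<and> 1 / h \<in> D1 \<inter> D2
      \<and> p \<in> D1 \<inter> D2 \<and> q \<in> D1 \<inter> D2 \<and> h = p * c + q" for c
  proof -
    consider "c \<in> D1 \<inter> D2" | "inverse c \<in> D1 \<inter> D2" "c \<notin> D1 \<inter> D2"
      | "inverse c \<notin> D1" "c \<notin> D2" | "inverse c \<notin> D2" "c \<notin> D1"
      using val by blast
    then show ?thesis
    proof cases
      case 1
      then show ?thesis using cl by (intro exI[of _ 1] exI[of _ 0] exI[of _ 1]) auto
    next
      case 2
      moreover have "c \<noteq> 0" using 2 cl(1) by auto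
      ultimately show ?thesis using cl
        by (intro exI[of _ c] exI[of _ 1] exI[of _ 0]) (auto simp: inverse_eq_divide)
    next
      case 3
      show ?thesis
        using opposite[OF D val 3] cl
        by (intro exI[of _ "1 + c"] exI[of _ 1] exI[of _ 1]) auto
    next
      case 4
      show ?thesis
        using opposite[OF D(2) D(1) val(2) val(1) 4] cl
        by (intro exI[of _ "1 + c"] exI[of _ 1] exI[of _ 1]) auto
    qed
  qed
  then show ?thesis unfolding bezout_in_field_def by blast
qed

section \<open>Discrete valuation subrings\<close>

text \<open>
  The representation \<open>f = t^n u\<close>, \<open>u\<close> a unit and \<open>n\<close> an integer, of every nonzero element; the two
  disjuncts take the place of an integer exponent.
\<close>

definition dvr_in_field :: "'a::field set \<Rightarrow> 'a \<Rightarrow> bool" where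
  "dvr_in_field L t \<longleftrightarrow> subring_of_field L \<and> t \<in> L \<and> inverse t \<notin> L \<and>
     (\<forall>f. f \<noteq> 0 \<longrightarrow> (\<exists>n u. u \<in> L \<and> inverse u \<in> L \<and> u \<noteq> 0 \<and> (f = t ^ n * u \<or> f = u / t ^ n)))"

lemma dvr_valuation:
  assumes "dvr_in_field L t"
  shows "f \<in> L \<or> inverse f \<in> L"
proof (cases "f = 0")
  case False
  have L: "subring_of_field L" "t \<in> L"
    using assms by (auto simp: dvr_in_field_def)
  obtain n u where u: "u \<in> L" "inverse u \<in> L" "f = t ^ n * u \<or> f = u / t ^ n"
    using assms False unfolding dvr_in_field_def by metis
  have tn: "t ^ n \<in> L" by (rule subring_power[OF L])
  from u(3) show ?thesis
  proof
    assume "f = t ^ n * u"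
    then show ?thesis using tn u subring_closed(4)[OF L(1)] by blast
  next
    assume "f = u / t ^ n"
    then have "inverse f = t ^ n * inverse u" by (simp add: field_simps)
    then show ?thesis using tn u subring_closed(4)[OF L(1)] by metis
  qed
qed (use assms subring_closed in \<open>auto simp: dvr_in_field_def\<close>)

lemma dvr_archimedean:
  assumes "dvr_in_field L t" and div: "\<And>n. d / t ^ n \<in> L"
  shows "d = 0"
proof (rule ccontr)
  assume "d \<noteq> 0"
  have L: "subring_of_field L" "t \<in> L" "inverse t \<notin> L"
    using assms by (auto simp: dvr_in_field_def)
  then have "t \<noteq> 0" using subring_closed(1)[OF L(1)] by auto
  obtain n u where u: "u \<in> L" "inverse u \<in> L" "u \<noteq> 0" "d = t ^ n * u \<or> d = u / t ^ n"
    using assms \<open>d \<noteq> 0\<close> unfolding dvr_in_field_def by metis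
  note cl = subring_closed(4)[OF L(1)]
  from u(4) have "inverse t \<in> L"
  proof
    assume d: "d = t ^ n * u"
    have "inverse t = d / t ^ Suc n * inverse u"
      using d u \<open>t \<noteq> 0\<close> by (simp add: field_simps)
    then show ?thesis using cl[OF div u(2)] by metis
  next
    assume d: "d = u / t ^ n"
    have "inverse t = d / t ^ 1 * (t ^ n * inverse u)"
      using d u \<open>t \<noteq> 0\<close> by (simp add: field_simps)
    then show ?thesis using cl[OF div cl[OF subring_power[OF L(1,2)] u(2)]] by metis
  qed
  then show False using L by blast
qed

section \<open>Localizing a polynomial ring at its indeterminate\<close>

lemma adjoin_subset:
  assumes "subring_of_field W" "S \<subseteq> W" "t \<in> W"
  shows "adjoin S t \<subseteq> W"
  using assms subring_power[OF assms(1,3)]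
  by (auto simp: adjoin_def poly_altdef intro!: subring_sum subring_closed)

lemma subring_adjoin:
  assumes S: "subring_of_field S"
  shows "subring_of_field (adjoin S t)"
  unfolding subring_of_field_def
proof (intro conjI ballI)
  show "0 \<in> adjoin S t" "1 \<in> adjoin S t"
    unfolding adjoin_def mem_Collect_eq using subring_closed(1,2)[OF S]
    by - (intro exI[of _ 0], simp, intro exI[of _ 1], auto)
next
  fix x y assume "x \<in> adjoin S t" "y \<in> adjoin S t"
  then obtain p q where p: "\<And>i. coeff p i \<in> S" "x = poly p t" and q: "\<And>i. coeff q i \<in> S" "y = poly q t"
    by (auto simp: adjoin_def)
  have "x - y = poly (p - q) t" "\<forall>i. coeff (p - q) i \<in> S"
    using p q by (auto intro: subring_closed[OF S])
  then show "x - y \<in> adjoin S t" unfolding adjoin_def by blast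
  have "x * y = poly (p * q) t" "\<forall>i. coeff (p * q) i \<in> S"
    using p q by (auto simp: coeff_mult intro!: subring_closed[OF S] subring_sum[OF S])
  then show "x * y \<in> adjoin S t" unfolding adjoin_def by blast
qed

lemma adjoin_contains:
  assumes S: "subring_of_field S"
  shows "S \<subseteq> adjoin S t" "t \<in> adjoin S t"
proof -
  show "S \<subseteq> adjoin S t"
  proof
    fix x assume "x \<in> S"
    then have "x = poly [:x:] t" "\<forall>i. coeff [:x:] i \<in> S"
      using subring_closed[OF S] by (auto simp: coeff_pCons split: nat.splits)
    then show "x \<in> adjoin S t" unfolding adjoin_def by blast
  qed
  have "t = poly [:0, 1:] t" "\<forall>i. coeff [:0, 1:] i \<in> S"
    using subring_closed[OF S] by (auto simp: coeff_pCons split: nat.splits)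
  then show "t \<in> adjoin S t" unfolding adjoin_def by blast
qed

lemma quot_field_subset:
  assumes W: "subring_of_field W" and "S \<subseteq> W" "\<And>x. x \<in> S \<Longrightarrow> x \<noteq> 0 \<Longrightarrow> inverse x \<in> W"
  shows "quot_field S \<subseteq> W"
  using assms subring_closed(4)[OF W] by (auto simp: quot_field_def divide_inverse)

lemma subset_quot_field:
  assumes "subring_of_field S"
  shows "S \<subseteq> quot_field S"
proof
  fix x assume "x \<in> S"
  moreover have "x = x / 1" by simp
  ultimately show "x \<in> quot_field S"
    using subring_closed(2)[OF assms] one_neq_zero unfolding quot_field_def by blast
qed

lemma subring_quot_field:
  assumes S: "subring_of_field S"
  shows "subring_of_field (quot_field S)"
  unfolding subring_of_field_def
proof (intro conjI ballI)
  show "0 \<in> quot_field S" "1 \<in> quot_field S"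
    using subset_quot_field[OF S] subring_closed(1,2)[OF S] by auto
next
  fix x y assume "x \<in> quot_field S" "y \<in> quot_field S"
  then obtain a b c d where *: "a \<in> S" "b \<in> S" "b \<noteq> 0" "c \<in> S" "d \<in> S" "d \<noteq> 0"
    "x = a / b" "y = c / d"
    by (auto simp: quot_field_def)
  have "x - y = (a * d - c * b) / (b * d)" "x * y = (a * c) / (b * d)"
    using * by (simp_all add: field_simps)
  moreover have "a * d - c * b \<in> S" "a * c \<in> S" "b * d \<in> S" "b * d \<noteq> 0"
    using * subring_closed[OF S] by auto
  ultimately show "x - y \<in> quot_field S" "x * y \<in> quot_field S"
    unfolding quot_field_def by blast+
qed

lemma inverse_quot_field:
  assumes S: "subring_of_field S" and "x \<in> quot_field S"
  shows "inverse x \<in> quot_field S"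
proof (cases "x = 0")
  case True
  then show ?thesis using assms by simp
next
  case False
  obtain a b where *: "a \<in> S" "b \<in> S" "x = a / b"
    using assms(2) by (auto simp: quot_field_def)
  then have "inverse x = b / a" "a \<noteq> 0" using False by auto
  then show ?thesis using * unfolding quot_field_def by blast
qed

text \<open>
  The transcendence of \<open>t\<close> over \<open>F\<close> enters only as \<open>1 / t \<notin> F[t]\<close>. This already makes \<open>t F[t]\<close> a
  prime ideal: elements outside it are those with nonzero constant coefficient, and if a product
  of two of them were in \<open>t F[t]\<close>, so would be the product of the constant coefficients, a unit.
\<close>

lemma dvr_localize_adjoin:
  assumes F: "subring_of_field F" and Finv: "\<And>x. x \<in> F \<Longrightarrow> inverse x \<in> F"
    and t: "inverse t \<notin> adjoin F t" and quot: "quot_field (adjoin F t) = UNIV"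
  shows "dvr_in_field (localize (adjoin F t) (t *o adjoin F t)) t"
    and "F \<subseteq> localize (adjoin F t) (t *o adjoin F t)"
proof -
  define S where "S = adjoin F t"
  define L where "L = localize S (t *o S)"
  have S: "subring_of_field S" and FS: "F \<subseteq> S" and tS: "t \<in> S" and it: "inverse t \<notin> S"
    using subring_adjoin[OF F] adjoin_contains[OF F] t by (auto simp: S_def)
  note cl = subring_closed[OF S]
  have t0: "t \<noteq> 0" using it cl(1) by auto
  have const: "c = 0" if "c \<in> F" "c \<in> t *o S" for c
  proof (rule ccontr)
    assume "c \<noteq> 0"
    obtain s where s: "s \<in> S" "c = t * s" using \<open>c \<in> t *o S\<close> by (auto simp: mem_elt_times_iff)
    have "inverse t = s * inverse c" using s(2) t0 \<open>c \<noteq> 0\<close> by (simp add: field_simps)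
    then show False using it s(1) Finv[OF \<open>c \<in> F\<close>] FS cl(4) by (metis subsetD)
  qed
  have ideal: "t * s \<in> t *o S" if "s \<in> S" for s using that by auto
  have split: "\<exists>c s. c \<in> F \<and> s \<in> S \<and> b = c + t * s" if "b \<in> S" for b
  proof -
    obtain p where p: "\<forall>i. coeff p i \<in> F" "b = poly p t"
      using \<open>b \<in> S\<close> by (auto simp: S_def adjoin_def)
    obtain a q where pq: "p = pCons a q" by (cases p)
    have "coeff p 0 = a" "\<And>i. coeff p (Suc i) = coeff q i" by (simp_all add: pq)
    then have "a \<in> F" "\<forall>i. coeff q i \<in> F" using p(1) by metis+
    then show ?thesis using p(2) pq by (auto simp: S_def adjoin_def)
  qed
  have prime: "b * b' \<in> S - t *o S" if b: "b \<in> S - t *o S" "b' \<in> S - t *o S" for b b'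
  proof -
    obtain c s c' s' where *: "c \<in> F" "s \<in> S" "b = c + t * s" "c' \<in> F" "s' \<in> S" "b' = c' + t * s'"
      using split b by (meson DiffD1)
    have "c \<noteq> 0" "c' \<noteq> 0" using * b ideal by auto
    moreover have "b * b' \<notin> t *o S"
    proof
      assume "b * b' \<in> t *o S"
      then obtain r where r: "r \<in> S" "b * b' = t * r" by (auto simp: mem_elt_times_iff)
      have "c * c' = t * (r - (c * s' + s * c' + t * s * s'))"
        using r(2) * by (simp add: algebra_simps)
      moreover have "r - (c * s' + s * c' + t * s * s') \<in> S"
        using r(1) * FS tS cl by (meson subsetD)
      ultimately have "c * c' \<in> t *o S" using ideal by metis
      then have "c * c' = 0" using const * subring_closed(4)[OF F] by metis
      then show False using \<open>c \<noteq> 0\<close> \<open>c' \<noteq> 0\<close> by simp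
    qed
    ultimately show ?thesis using b cl(4) by blast
  qed
  have one: "1 \<in> S - t *o S" using const[of 1] subring_closed(2)[OF F] cl(2) by auto
  have nz: "b \<noteq> 0" if "b \<in> S - t *o S" for b using that ideal[OF cl(1)] by auto
  have SL: "S \<subseteq> L"
  proof
    fix x assume "x \<in> S"
    moreover have "x = x / 1" by simp
    ultimately show "x \<in> L" using one unfolding L_def localize_def by blast
  qed
  have L: "subring_of_field L"
    unfolding subring_of_field_def
  proof (intro conjI ballI)
    show "0 \<in> L" "1 \<in> L" using SL cl by auto
  next
    fix x y assume "x \<in> L" "y \<in> L"
    then obtain a b c d where *: "a \<in> S" "b \<in> S - t *o S" "c \<in> S" "d \<in> S - t *o S"
      "x = a / b" "y = c / d"
      unfolding L_def localize_def by blast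
    have "x - y = (a * d - c * b) / (b * d)" "x * y = (a * c) / (b * d)"
      using * nz[OF *(2)] nz[OF *(4)] by (simp_all add: field_simps)
    moreover have "a * d - c * b \<in> S" "a * c \<in> S" using * cl by auto
    ultimately show "x - y \<in> L" "x * y \<in> L"
      using prime[OF *(2,4)] unfolding L_def localize_def by blast+
  qed
  have "inverse t \<notin> L"
  proof
    assume "inverse t \<in> L"
    then obtain a b where *: "a \<in> S" "b \<in> S - t *o S" "inverse t = a / b"
      unfolding L_def localize_def by blast
    have "b = t * a" using *(3) t0 nz[OF *(2)] by (simp add: field_simps)
    then show False using *(1,2) ideal by blast
  qed
  have order: "\<exists>n b. s = t ^ n * b \<and> b \<in> S - t *o S" if s: "s \<in> S" "s \<noteq> 0" for s
  proof -
    obtain p where p: "\<forall>i. coeff p i \<in> F" "s = poly p t"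
      using s(1) by (auto simp: S_def adjoin_def)
    have "poly p t \<noteq> 0 \<Longrightarrow> \<exists>n b. poly p t = t ^ n * b \<and> b \<in> S - t *o S"
      using p(1)
    proof (induction p)
      case 0
      then show ?case by simp
    next
      case (pCons a q)
      have "a \<in> F" "\<forall>i. coeff q i \<in> F"
        using pCons.prems(2) by (metis coeff_pCons_0, metis coeff_pCons_Suc)
      then have qS: "poly q t \<in> S" by (auto simp: S_def adjoin_def)
      show ?case
      proof (cases "a = 0")
        case True
        then obtain n b where "poly q t = t ^ n * b" "b \<in> S - t *o S"
          using pCons.IH pCons.prems(1) \<open>\<forall>i. coeff q i \<in> F\<close> by auto
        then show ?thesis using True
          by (intro exI[of _ "Suc n"] exI[of _ b]) simp
      next
        case False
        have "poly (pCons a q) t \<notin> t *o S"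
        proof
          assume "poly (pCons a q) t \<in> t *o S"
          then obtain r where "r \<in> S" "poly (pCons a q) t = t * r" by (auto simp: mem_elt_times_iff)
          then have "a = t * (r - poly q t)" "r - poly q t \<in> S"
            using cl(3) qS by (auto simp: algebra_simps)
          then show False using const[OF \<open>a \<in> F\<close>] ideal False by metis
        qed
        moreover have "poly (pCons a q) t \<in> S"
          using \<open>a \<in> F\<close> FS qS tS cl by auto
        ultimately show ?thesis by (intro exI[of _ 0] exI[of _ "poly (pCons a q) t"]) simp
      qed
    qed
    then show ?thesis using s(2) p(2) by blast
  qed
  have "\<exists>n u. u \<in> L \<and> inverse u \<in> L \<and> u \<noteq> 0 \<and> (f = t ^ n * u \<or> f = u / t ^ n)" if "f \<noteq> 0" for f
  proof -
    obtain a b where ab: "a \<in> S" "b \<in> S" "b \<noteq> 0" "f = a / b"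
      using quot unfolding S_def[symmetric] quot_field_def by blast
    then have "a \<noteq> 0" using that by auto
    obtain m a' n b' where *: "a = t ^ m * a'" "a' \<in> S - t *o S" "b = t ^ n * b'" "b' \<in> S - t *o S"
      using order[OF ab(1) \<open>a \<noteq> 0\<close>] order[OF ab(2,3)] by blast
    define u where "u = a' / b'"
    have u: "u \<in> L" "inverse u \<in> L" "u \<noteq> 0"
      using * nz[OF *(2)] nz[OF *(4)] by (auto simp: u_def L_def localize_def)
    have f: "f = t ^ m * u / t ^ n"
      using ab(4) * by (simp add: u_def)
    show ?thesis
    proof (cases "n \<le> m")
      case True
      then have "f = t ^ (m - n) * u" using f t0 by (simp add: power_diff)
      then show ?thesis using u by blast
    next
      case False
      then have "f = u / t ^ (n - m)" using f t0 by (simp add: power_diff)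
      then show ?thesis using u by blast
    qed
  qed
  then show "dvr_in_field (localize (adjoin F t) (t *o adjoin F t)) t"
    using L \<open>inverse t \<notin> L\<close> SL tS unfolding dvr_in_field_def L_def S_def by blast
  show "F \<subseteq> localize (adjoin F t) (t *o adjoin F t)"
    using FS SL unfolding L_def S_def by blast
qed

section \<open>The two valuation rings of \<open>k(X,Y)\<close>\<close>

text \<open>The localization of \<open>'a\<close> at the prime ideal generated by \<open>t\<close>.\<close>

lemma subring_fractions_prime:
  fixes t :: "'a::idom"
  assumes "prime_elem t"
  defines "T \<equiv> {to_fract p / to_fract g | p g. \<not> t dvd g}"
  shows "subring_of_field T" "inverse (to_fract t) \<notin> T"
proof -
  have one: "\<not> t dvd 1" using assms(1) by (simp add: prime_elem_def)
  have nz: "to_fract g \<noteq> 0" if "\<not> t dvd g" for g :: 'a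
    using that by auto
  show "subring_of_field T"
    unfolding subring_of_field_def
  proof (intro conjI ballI)
    have "(0 :: 'a fract) = to_fract 0 / to_fract 1" "(1 :: 'a fract) = to_fract 1 / to_fract 1"
      by simp_all
    then show "0 \<in> T" "1 \<in> T"
      unfolding T_def using one by blast+
  next
    fix x y assume "x \<in> T" "y \<in> T"
    then obtain p g q h where *: "\<not> t dvd g" "\<not> t dvd h" "x = to_fract p / to_fract g"
      "y = to_fract q / to_fract h"
      unfolding T_def by blast
    have "x - y = to_fract (p * h - q * g) / to_fract (g * h)"
      "x * y = to_fract (p * q) / to_fract (g * h)"
      unfolding *(3,4) using nz[OF *(1)] nz[OF *(2)] by (simp_all add: field_simps)
    moreover have "\<not> t dvd g * h"
      using *(1,2) assms(1) by (simp add: prime_elem_dvd_mult_iff)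
    ultimately show "x - y \<in> T" "x * y \<in> T"
      unfolding T_def by blast+
  qed
  show "inverse (to_fract t) \<notin> T"
  proof
    assume "inverse (to_fract t) \<in> T"
    then obtain p g where *: "\<not> t dvd g" "inverse (to_fract t) = to_fract p / to_fract g"
      unfolding T_def by blast
    have "to_fract t \<noteq> 0" using assms(1) by auto
    then have "to_fract g = to_fract (t * p)"
      using *(2) nz[OF *(1)] by (simp add: field_simps)
    then have "g = t * p" by (simp only: to_fract_eq_iff)
    then show False using *(1) by simp
  qed
qed

lemma to_fract_in_subring:
  assumes W: "subring_of_field W" and "base_field \<subseteq> W" "indet_X \<in> W" "indet_Y \<in> W"
  shows "to_fract p \<in> W"
proof (induction p)
  case 0
  then show ?case using subring_closed(1)[OF W] by simp
next
  case (pCons q p)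
  have "to_fract [:q:] \<in> W"
  proof (induction q)
    case 0
    then show ?case using subring_closed(1)[OF W] by simp
  next
    case (pCons c q)
    have "[:pCons c q:] = [:[:c:]:] + [:[:0, 1:]:] * [:q:]" by simp
    then have "to_fract [:pCons c q:] = to_fract [:[:c:]:] + indet_X * to_fract [:q:]"
      unfolding indet_X_def by (simp only: to_fract_add to_fract_mult)
    moreover have "to_fract [:[:c:]:] \<in> W" using assms(2) by (auto simp: base_field_def)
    ultimately show ?case using assms(3) pCons.IH subring_closed[OF W] by metis
  qed
  moreover have "pCons q p = [:q:] + [:0, 1:] * p" by simp
  then have "to_fract (pCons q p) = to_fract [:q:] + indet_Y * to_fract p"
    unfolding indet_Y_def by (simp only: to_fract_add to_fract_mult)
  ultimately show ?case using assms(4) pCons.IH subring_closed[OF W] by metis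
qed

text \<open>
  Here \<open>G\<close> plays the part of \<open>k[s]\<close> inside \<open>k[X,Y]\<close>. Both \<open>k(s)\<close> and \<open>t\<close> lie in the localization
  of \<open>k[X,Y]\<close> at the prime \<open>(t)\<close>, since \<open>t\<close> divides no nonzero element of \<open>k[s]\<close>; and \<open>1 / t\<close>
  does not lie in it, which is the transcendence needed above.
\<close>

lemma dvr_local_poly_ring:
  fixes s t :: "'k::field rat_fun2" and t' :: "'k poly poly"
  assumes st: "{s, t} = {indet_X, indet_Y}"
    and t: "t = to_fract t'" "prime_elem t'"
    and G: "subring_of_field (to_fract ` G)" "base_field \<subseteq> to_fract ` G" "s \<in> to_fract ` G"
    and ndvd: "\<And>g. g \<in> G \<Longrightarrow> t' dvd g \<Longrightarrow> g = 0"
  shows "dvr_in_field (local_poly_ring s t) t" "inverse s \<in> local_poly_ring s t"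
proof -
  define B where "B = adjoin base_field s"
  define F where "F = quot_field B"
  have "subring_of_field (base_field :: 'k rat_fun2 set)"
    unfolding subring_of_field_def
  proof (intro conjI ballI)
    show "0 \<in> (base_field :: 'k rat_fun2 set)" "1 \<in> (base_field :: 'k rat_fun2 set)"
      unfolding base_field_def
      by (rule range_eqI[of _ _ 0], simp) (rule range_eqI[of _ _ 1], simp flip: one_pCons)
  next
    fix x y :: "'k rat_fun2" assume "x \<in> base_field" "y \<in> base_field"
    then obtain a b where *: "x = to_fract [:[:a:]:]" "y = to_fract [:[:b:]:]"
      by (auto simp: base_field_def)
    have "x - y = to_fract [:[:a - b:]:]" "x * y = to_fract [:[:a * b:]:]"
      unfolding * by (simp_all del: to_fract_diff to_fract_mult flip: to_fract_diff to_fract_mult)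
    then show "x - y \<in> base_field" "x * y \<in> base_field"
      by (auto simp: base_field_def)
  qed
  then have B: "subring_of_field B" "base_field \<subseteq> B" "s \<in> B"
    unfolding B_def by (rule subring_adjoin, rule adjoin_contains, rule adjoin_contains)
  have F: "subring_of_field F" "\<And>x. x \<in> F \<Longrightarrow> inverse x \<in> F" "base_field \<subseteq> F" "s \<in> F"
    using B subring_quot_field[OF B(1)] inverse_quot_field[OF B(1)] subset_quot_field[OF B(1)]
    unfolding F_def by blast+
  define T where "T = {to_fract p / to_fract g | p g. \<not> t' dvd g}"
  have T: "subring_of_field T" "inverse t \<notin> T"
    using subring_fractions_prime[OF t(2)] unfolding T_def t(1) by blast+
  have one: "\<not> t' dvd 1" using t(2) by (simp add: prime_elem_def)
  have polys: "to_fract p \<in> T" for p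
  proof -
    have "to_fract p = to_fract p / to_fract 1" by simp
    then show ?thesis using one unfolding T_def by blast
  qed
  have "F \<subseteq> T"
    unfolding F_def
  proof (rule quot_field_subset[OF T(1)])
    have BG: "B \<subseteq> to_fract ` G" unfolding B_def using G by (rule adjoin_subset)
    then show "B \<subseteq> T" using polys by auto
    fix x assume "x \<in> B" "x \<noteq> 0"
    then obtain g where "g \<in> G" "x = to_fract g" "g \<noteq> 0" using BG by auto
    then have "inverse x = to_fract 1 / to_fract g" "\<not> t' dvd g"
      using ndvd by (auto simp: inverse_eq_divide)
    then show "inverse x \<in> T" unfolding T_def by blast
  qed
  then have "adjoin F t \<subseteq> T"
    using adjoin_subset[OF T(1)] polys t(1) by metis
  then have nt: "inverse t \<notin> adjoin F t" using T(2) by blast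
  have quot: "quot_field (adjoin F t) = UNIV"
  proof -
    have S: "subring_of_field (adjoin F t)" "F \<subseteq> adjoin F t" "t \<in> adjoin F t"
      using subring_adjoin adjoin_contains F(1) by blast+
    have "{indet_X, indet_Y} \<subseteq> adjoin F t"
      unfolding st[symmetric] using S F(4) by blast
    then have in_S: "to_fract p \<in> adjoin F t" for p
      using S F(3) by (intro to_fract_in_subring) auto
    have "f \<in> quot_field (adjoin F t)" for f
    proof (cases f)
      case (Fract a b)
      then have "f = to_fract a / to_fract b" "to_fract b \<noteq> 0"
        by (simp_all add: Fract_conv_to_fract)
      then show ?thesis using in_S unfolding quot_field_def by blast
    qed
    then show ?thesis by blast
  qed
  have loc: "local_poly_ring s t = localize (adjoin F t) (t *o adjoin F t)"
    by (simp add: local_poly_ring_def poly_over_rat_fun_def F_def B_def)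
  show "dvr_in_field (local_poly_ring s t) t" "inverse s \<in> local_poly_ring s t"
    using dvr_localize_adjoin[OF F(1,2) nt quot] F(2)[OF F(4)] unfolding loc by blast+
qed

lemma indet_dvd_iff: "[:0, 1:] dvd p \<longleftrightarrow> poly p 0 = 0" for p :: "'a::idom poly"
  using poly_eq_0_iff_dvd[of p 0] by simp

lemma prime_elem_indet: "prime_elem [:0, 1 :: 'a::idom:]"
  by (rule prime_elemI) (simp_all add: indet_dvd_iff)

lemma dvr_X_Y:
  "dvr_in_field (local_poly_ring indet_X (indet_Y :: 'k::field rat_fun2)) indet_Y"
  "inverse indet_X \<in> local_poly_ring indet_X (indet_Y :: 'k rat_fun2)"
proof -
  \<comment> \<open>\<open>k[X]\<close> consists of the polynomials that are constant in the outer variable\<close>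
  define G :: "'k poly poly set" where "G = range (\<lambda>q. [:q:])"
  have G_iff: "P \<in> G \<longleftrightarrow> (\<exists>q. P = [:q:])" for P
    by (auto simp: G_def)
  have "subring_of_field (to_fract ` G)"
    unfolding subring_of_field_def
  proof (intro conjI ballI)
    have "0 \<in> G" "1 \<in> G"
      unfolding G_iff by (rule exI[of _ 0], simp) (rule exI[of _ 1], simp add: one_pCons)
    then show "0 \<in> to_fract ` G" "1 \<in> to_fract ` G"
      by (metis imageI to_fract_0, metis imageI to_fract_1)
  next
    fix x y assume "x \<in> to_fract ` G" "y \<in> to_fract ` G"
    then obtain p q where *: "p \<in> G" "q \<in> G" "x = to_fract p" "y = to_fract q" by blast
    then have "p - q \<in> G" "p * q \<in> G" by (auto simp: G_iff)
    then show "x - y \<in> to_fract ` G" "x * y \<in> to_fract ` G"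
      unfolding *(3,4) by (simp_all del: to_fract_diff to_fract_mult flip: to_fract_diff to_fract_mult)
  qed
  moreover have "base_field \<subseteq> to_fract ` G" "indet_X \<in> to_fract ` G"
    by (auto simp: base_field_def indet_X_def G_iff)
  moreover have "g = 0" if "g \<in> G" "[:0, 1:] dvd g" for g
    using that by (auto simp: indet_dvd_iff G_iff)
  ultimately show "dvr_in_field (local_poly_ring indet_X (indet_Y :: 'k rat_fun2)) indet_Y"
    "inverse indet_X \<in> local_poly_ring indet_X (indet_Y :: 'k rat_fun2)"
    using dvr_local_poly_ring[OF refl indet_Y_def prime_elem_indet, of G] by blast+
qed

lemma dvr_Y_X:
  "dvr_in_field (local_poly_ring indet_Y (indet_X :: 'k::field rat_fun2)) indet_X"
  "inverse indet_Y \<in> local_poly_ring indet_Y (indet_X :: 'k rat_fun2)"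
proof -
  \<comment> \<open>\<open>k[Y]\<close> consists of the polynomials with all coefficients constant in the inner variable\<close>
  define G :: "'k poly poly set" where "G = {P. \<forall>i. degree (coeff P i) = 0}"
  have st: "{indet_Y, indet_X} = {indet_X, indet_Y :: 'k rat_fun2}" by blast
  have "subring_of_field (to_fract ` G)"
    unfolding subring_of_field_def
  proof (intro conjI ballI)
    have "0 \<in> G" "1 \<in> G" by (simp_all add: G_def coeff_1)
    then show "0 \<in> to_fract ` G" "1 \<in> to_fract ` G"
      by (metis imageI to_fract_0, metis imageI to_fract_1)
  next
    fix x y assume "x \<in> to_fract ` G" "y \<in> to_fract ` G"
    then obtain p q where *: "p \<in> G" "q \<in> G" "x = to_fract p" "y = to_fract q" by blast
    have "p - q \<in> G"
      using *(1,2) degree_diff_le[of "coeff p i" 0 "coeff q i" for i] by (simp add: G_def)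
    moreover have "degree (coeff p i * coeff q j) = 0" for i j
      using *(1,2) degree_mult_le[of "coeff p i" "coeff q j"] by (simp add: G_def)
    then have "degree (coeff (p * q) n) \<le> 0" for n
      unfolding coeff_mult by (intro degree_sum_le) auto
    then have "p * q \<in> G" by (simp add: G_def)
    ultimately show "x - y \<in> to_fract ` G" "x * y \<in> to_fract ` G"
      unfolding *(3,4) by (simp_all del: to_fract_diff to_fract_mult flip: to_fract_diff to_fract_mult)
  qed
  moreover have "g = 0" if "g \<in> G" "[:[:0, 1:]:] dvd g" for g
  proof (rule poly_eqI)
    fix i
    obtain c where c: "coeff g i = [:c:]"
      using \<open>g \<in> G\<close> by (auto simp: G_def elim: degree_eq_zeroE)
    have "[:0, 1:] dvd coeff g i" using that(2) by (simp add: const_poly_dvd_iff)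
    then show "coeff g i = coeff 0 i"
      unfolding c by (simp add: indet_dvd_iff)
  qed
  moreover have "base_field \<subseteq> to_fract ` G" "indet_Y \<in> to_fract ` G"
    by (auto simp: base_field_def indet_Y_def G_def coeff_pCons split: nat.splits)
  ultimately show "dvr_in_field (local_poly_ring indet_Y (indet_X :: 'k rat_fun2)) indet_X"
    "inverse indet_Y \<in> local_poly_ring indet_Y (indet_X :: 'k rat_fun2)"
    using dvr_local_poly_ring[OF st indet_X_def lift_prime_elem_poly[OF prime_elem_indet], of G]
    by blast+
qed

section \<open>Power series with restricted constant coefficient\<close>

text \<open>
  For an additive subgroup \<open>W\<close> this is \<open>W + M\<close>, the pullback of \<open>W\<close> along the residue map \<open>V \<rightarrow> K\<close>; taking
  \<open>W = 0\<close> and \<open>W = K\<close> gives \<open>M\<close> and \<open>V\<close>.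
\<close>

definition series_over :: "'a::field set \<Rightarrow> 'a fls set" where
  "series_over W = fps_to_fls ` {F. fps_nth F 0 \<in> W}"

lemma series_overI: "fps_nth F 0 \<in> W \<Longrightarrow> fps_to_fls F \<in> series_over W"
  by (simp add: series_over_def)

lemma series_overE:
  assumes "x \<in> series_over W"
  obtains F where "fps_nth F 0 \<in> W" "x = fps_to_fls F"
  using assms by (auto simp: series_over_def)

lemma fps_to_fls_in_series_over_iff: "fps_to_fls F \<in> series_over W \<longleftrightarrow> fps_nth F 0 \<in> W"
  by (auto simp: series_over_def)

lemma series_over_mono: "W \<subseteq> W' \<Longrightarrow> series_over W \<subseteq> series_over W'"
  by (auto simp: series_over_def)

lemma series_over_Int: "series_over W \<inter> series_over W' = series_over (W \<inter> W')"
  by (auto simp: series_over_def)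

lemma series_over_UNIV: "series_over UNIV = range fps_to_fls"
  by (simp add: series_over_def)

lemma series_over_mult:
  assumes "x \<in> series_over U" "y \<in> series_over W" "\<And>a b. a \<in> U \<Longrightarrow> b \<in> W \<Longrightarrow> a * b \<in> W'"
  shows "x * y \<in> series_over W'"
  using assms by (auto elim!: series_overE simp flip: fls_times_fps_to_fls intro!: series_overI)

lemma series_over_diff:
  assumes "x \<in> series_over U" "y \<in> series_over W" "\<And>a b. a \<in> U \<Longrightarrow> b \<in> W \<Longrightarrow> a - b \<in> W'"
  shows "x - y \<in> series_over W'"
  using assms by (auto elim!: series_overE simp flip: fps_to_fls_minus intro!: series_overI)

lemma subring_series_over:
  assumes W: "subring_of_field W"
  shows "subring_of_field (series_over W)"
  unfolding subring_of_field_def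
proof (intro conjI ballI)
  show "0 \<in> series_over W" "1 \<in> series_over W"
    using series_overI[of 0 W] series_overI[of 1 W] subring_closed[OF W] by simp_all
qed (auto elim: series_over_mult series_over_diff intro: subring_closed[OF W])

lemma X_times_series: "fls_X *o range fps_to_fls = series_over {0}"
proof (intro equalityI subsetI)
  fix x :: "'a fls" assume "x \<in> fls_X *o range fps_to_fls"
  then obtain F where "x = fls_X * fps_to_fls F" by (auto simp: mem_elt_times_iff)
  then have "x = fps_to_fls (fps_X * F)" by (simp add: fls_times_fps_to_fls)
  then show "x \<in> series_over {0}" by (simp add: fps_to_fls_in_series_over_iff)
next
  fix x :: "'a fls" assume "x \<in> series_over {0}"
  then obtain F where F: "fps_nth F 0 = 0" "x = fps_to_fls F" by (auto elim: series_overE)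
  have "F = fps_X * fps_shift 1 F" using F(1) by (auto simp: fps_eq_iff)
  then have "x = fls_X * fps_to_fls (fps_shift 1 F)"
    using F(2) by (metis fls_times_fps_to_fls fps_X_to_fls)
  then show "x \<in> fls_X *o range fps_to_fls" by (auto simp: mem_elt_times_iff)
qed

lemma const_plus_series: "fls_const ` W + series_over {0} = series_over W"
proof (intro equalityI subsetI)
  fix x assume "x \<in> fls_const ` W + series_over {0}"
  then obtain c F where "c \<in> W" "fps_nth F 0 = 0" "x = fls_const c + fps_to_fls F"
    by (auto elim!: set_plus_elim series_overE)
  then have "x = fps_to_fls (fps_const c + F)" "fps_nth (fps_const c + F) 0 \<in> W" by simp_all
  then show "x \<in> series_over W" using series_overI by metis
next
  fix x assume "x \<in> series_over W"
  then obtain F where F: "fps_nth F 0 \<in> W" "x = fps_to_fls F" by (rule series_overE)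
  have "x = fls_const (fps_nth F 0) + fps_to_fls (F - fps_const (fps_nth F 0))"
    by (simp add: F(2))
  moreover have "fps_to_fls (F - fps_const (fps_nth F 0)) \<in> series_over {0}"
    by (rule series_overI) simp
  ultimately show "x \<in> fls_const ` W + series_over {0}"
    using F(1) by (metis imageI set_plus_intro)
qed

lemma maximal_ideal_of_local:
  assumes R: "subring_of_field R" and M: "ideal_of R M" "M \<noteq> R"
    and units: "\<And>x. x \<in> R \<Longrightarrow> x \<notin> M \<Longrightarrow> x \<noteq> 0 \<and> inverse x \<in> R"
  shows "maximal_ideal_of R I \<longleftrightarrow> I = M"
proof -
  have sub: "J \<subseteq> M" if J: "ideal_of R J" "J \<noteq> R" for J
  proof (rule ccontr)
    assume "\<not> J \<subseteq> M"
    then obtain x where x: "x \<in> J" "x \<notin> M" by blast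
    then have "x \<in> R" using J(1) by (auto simp: ideal_of_def)
    then have "x \<noteq> 0" "inverse x \<in> R" using units x(2) by blast+
    then have "inverse x * x \<in> J"
      using x(1) J(1) unfolding ideal_of_def submodule_of_field_def by blast
    then have "r * 1 \<in> J" if "r \<in> R" for r
      using that J(1) \<open>x \<noteq> 0\<close> unfolding ideal_of_def submodule_of_field_def by (metis left_inverse)
    then show False using J by (auto simp: ideal_of_def)
  qed
  show ?thesis
  proof
    assume "maximal_ideal_of R I"
    then show "I = M" using sub[of I] M unfolding maximal_ideal_of_def by metis
  next
    assume "I = M"
    then show "maximal_ideal_of R I"
      using M sub unfolding maximal_ideal_of_def by blast
  qed
qed

lemma maximal_ideal_power_series:
  "maximal_ideal_of (range fps_to_fls) I \<longleftrightarrow> I = series_over {0 :: 'a::field}"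
proof (rule maximal_ideal_of_local)
  let ?V = "range fps_to_fls :: 'a fls set"
  show V: "subring_of_field ?V"
    unfolding series_over_UNIV[symmetric]
    by (rule subring_series_over) (simp add: subring_of_field_def)
  show "ideal_of ?V (series_over {0})"
    using submodule_principal[OF V, of fls_X] X_times_series[where 'a = 'a]
      series_over_mono[of "{0 :: 'a}" UNIV]
    by (simp add: ideal_of_def series_over_UNIV)
  show "series_over {0} \<noteq> ?V"
    using fps_to_fls_in_series_over_iff[of 1 "{0 :: 'a}"] by auto
  fix x :: "'a fls" assume x: "x \<in> ?V" "x \<notin> series_over {0}"
  then obtain F where F: "x = fps_to_fls F" "fps_nth F 0 \<noteq> 0"
    by (auto simp: fps_to_fls_in_series_over_iff)
  then have "inverse x = fps_to_fls (inverse F)" "x \<noteq> 0"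
    by (auto simp: fls_inverse_fps_to_fls subdegree_eq_0)
  then show "x \<noteq> 0 \<and> inverse x \<in> ?V" by auto
qed

text \<open>
  Elements of nonzero order cause no trouble, since \<open>x\<close> or \<open>1 / x\<close> lies in the ideal of series
  without constant term, which \<open>series_over D\<close> contains. For \<open>x\<close> of order \<open>0\<close> a generator
  for the constant term of \<open>x\<close> works, up to a correction in that ideal.
\<close>

lemma bezout_series_over:
  fixes D :: "'a::field set"
  assumes D: "subring_of_field D" and bez: "bezout_in_field D"
  shows "bezout_in_field (series_over D)"
  unfolding bezout_in_field_def
proof
  fix x :: "'a fls"
  let ?R = "series_over D"
  have R: "subring_of_field ?R" by (rule subring_series_over[OF D])
  note cl = subring_closed[OF R]
  have pos: "y \<in> ?R" if "y = 0 \<or> fls_subdegree y > 0" for y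
  proof -
    have "y = fps_to_fls (fls_regpart y)" using that by auto
    moreover have "fps_nth (fls_regpart y) 0 = 0" using that by auto
    ultimately show ?thesis
      using subring_closed(1)[OF D] by (metis series_overI)
  qed
  consider "x = 0 \<or> fls_subdegree x > 0" | "x \<noteq> 0" "fls_subdegree x < 0"
    | "x \<noteq> 0" "fls_subdegree x = 0" by linarith
  then show "\<exists>h p q. h \<noteq> 0 \<and> x / h \<in> ?R \<and> 1 / h \<in> ?R \<and> p \<in> ?R \<and> q \<in> ?R \<and> h = p * x + q"
  proof cases
    case 1
    then show ?thesis
      using pos cl(1,2) by (intro exI[of _ 1] exI[of _ 0] exI[of _ 1]) auto
  next
    case 2
    have "inverse x \<in> ?R" using 2 by (intro pos) auto
    then show ?thesis
      using 2 cl(1,2) by (intro exI[of _ x] exI[of _ 1] exI[of _ 0]) (auto simp: inverse_eq_divide)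
  next
    case 3
    define F where "F = fls_regpart x"
    have x: "x = fps_to_fls F" using 3(2) by (simp add: F_def)
    obtain h p q where h: "h \<noteq> 0" "fps_nth F 0 / h \<in> D" "1 / h \<in> D" "p \<in> D" "q \<in> D"
      "h = p * fps_nth F 0 + q"
      using bez unfolding bezout_in_field_def by metis
    define h' where "h' = fls_const h"
    have inv: "inverse h' = fps_to_fls (fps_const (1 / h))"
      using h(1) by (simp add: h'_def fls_inverse_const flip: inverse_eq_divide)
    have "h' \<noteq> 0" using h(1) by (simp add: h'_def)
    moreover have "1 / h' \<in> ?R"
      unfolding divide_inverse inv mult_1 using h(3) by (intro series_overI) (simp add: divide_inverse)
    moreover have "x / h' = fps_to_fls (F * fps_const (1 / h))"
      by (simp only: divide_inverse inv x fls_times_fps_to_fls)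
    then have "x / h' \<in> ?R" using h(2) by (simp add: series_overI)
    moreover have "fls_const p \<in> ?R"
      using series_overI[of "fps_const p" D] h(4) by simp
    moreover have "h' - fls_const p * x \<in> ?R"
    proof -
      have "h' - fls_const p * x = fps_to_fls (fps_const h - fps_const p * F)"
        by (simp add: h'_def x fls_times_fps_to_fls)
      moreover have "fps_nth (fps_const h - fps_const p * F) 0 = q"
        by (simp add: h(6))
      ultimately show ?thesis
        using h(5) series_overI by metis
    qed
    moreover have "h' = fls_const p * x + (h' - fls_const p * x)" by simp
    ultimately show ?thesis by blast
  qed
qed

section \<open>The failure of stability for two independent valuation rings\<close>

context
  fixes D1 D2 :: "'a::field set" and t1 t2 :: 'a
  assumes dvr: "dvr_in_field D1 t1" "dvr_in_field D2 t2"
    and indep: "inverse t1 \<in> D2" "inverse t2 \<in> D1"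
begin

lemma subring_D: "subring_of_field D1" "subring_of_field D2" "subring_of_field (D1 \<inter> D2)"
  using dvr by (auto simp: dvr_in_field_def subring_Int)

lemma bezout_R: "bezout_in_field (series_over (D1 \<inter> D2))"
  by (intro bezout_series_over bezout_Int_valuation_rings subring_D dvr_valuation[OF dvr(1)]
      dvr_valuation[OF dvr(2)])

text \<open>
  \<open>D1\<close> contains \<open>1 / t2\<close> to every power, so \<open>d\<close> has infinite value under the valuation of \<open>D2\<close>.
\<close>

lemma annihilator_D1:
  assumes "\<And>a. a \<in> D1 \<Longrightarrow> d * a \<in> D2"
  shows "d = 0"
proof (rule dvr_archimedean[OF dvr(2)])
  fix n
  have "d * inverse t2 ^ n \<in> D2"
    by (rule assms) (rule subring_power[OF subring_D(1) indep(2)])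
  then show "d / t2 ^ n \<in> D2" by (simp add: divide_inverse power_inverse)
qed

text \<open>
  If \<open>x Z (D1 + M) \<subseteq> R\<close>, then the constant term \<open>d\<close> of \<open>x Z\<close> satisfies \<open>d D1 \<subseteq> D2\<close>, hence
  vanishes, and \<open>x\<close> has no pole. The converse is \<open>V M \<subseteq> M \<subseteq> R\<close>.
\<close>

lemma frac_inv_A:
  "frac_inv (series_over (D1 \<inter> D2)) (fls_X *o series_over D1) = range fps_to_fls"
proof (intro equalityI subsetI)
  fix x assume "x \<in> frac_inv (series_over (D1 \<inter> D2)) (fls_X *o series_over D1)"
  then have x: "x * (fls_X * y) \<in> series_over (D1 \<inter> D2)" if "y \<in> series_over D1" for y
    using that unfolding frac_inv_def by blast
  have "1 \<in> series_over D1" using subring_closed(2)[OF subring_series_over[OF subring_D(1)]] .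
  then have "x * (fls_X * 1) \<in> series_over (D1 \<inter> D2)" by (rule x)
  then obtain F where F: "x * fls_X = fps_to_fls F"
    by (auto elim: series_overE)
  have "fps_nth F 0 = 0"
  proof (rule annihilator_D1)
    fix a assume "a \<in> D1"
    then have "fls_const a \<in> series_over D1"
      using series_overI[of "fps_const a" D1] by simp
    then have "x * (fls_X * fls_const a) \<in> series_over (D1 \<inter> D2)" by (rule x)
    also have "x * (fls_X * fls_const a) = x * fls_X * fls_const a" by (simp only: mult.assoc)
    also have "\<dots> = fps_to_fls (F * fps_const a)"
      by (simp only: F fls_times_fps_to_fls fps_const_to_fls)
    finally have "fps_to_fls (F * fps_const a) \<in> series_over (D1 \<inter> D2)" .
    then show "fps_nth F 0 * a \<in> D2" by (simp add: fps_to_fls_in_series_over_iff)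
  qed
  then have "x * fls_X \<in> fls_X *o range fps_to_fls"
    unfolding F X_times_series by (simp add: series_overI)
  then obtain y where "y \<in> range fps_to_fls" "x * fls_X = fls_X * y"
    by (auto simp: mem_elt_times_iff)
  then show "x \<in> range fps_to_fls" by (simp add: mult.commute)
next
  fix x :: "'a fls" assume x: "x \<in> range fps_to_fls"
  have "x * (fls_X * y) \<in> series_over (D1 \<inter> D2)" if "y \<in> series_over D1" for y
  proof -
    have "fls_X * (x * y) \<in> series_over {0}"
      unfolding X_times_series[symmetric] using that x
      by (auto elim!: series_overE simp flip: fls_times_fps_to_fls)
    then show ?thesis
      using series_over_mono[of "{0}" "D1 \<inter> D2"] subring_closed(1)[OF subring_D(3)]
      by (auto simp: mult.left_commute)
  qed
  then show "x \<in> frac_inv (series_over (D1 \<inter> D2)) (fls_X *o series_over D1)"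
    by (auto simp: frac_inv_def bezout_quot_field[OF bezout_R] mem_elt_times_iff)
qed

text \<open>The constant term \<open>d\<close> of \<open>x\<close> now satisfies even \<open>d K \<subseteq> D\<close>.\<close>

lemma frac_inv_V:
  "frac_inv (series_over (D1 \<inter> D2)) (range fps_to_fls) = series_over {0}"
proof (intro equalityI subsetI)
  fix x assume "x \<in> frac_inv (series_over (D1 \<inter> D2)) (range fps_to_fls)"
  then have x: "x * fps_to_fls G \<in> series_over (D1 \<inter> D2)" for G
    unfolding frac_inv_def by blast
  from x[of 1] obtain F where F: "x = fps_to_fls F" by (auto elim: series_overE)
  have "fps_nth F 0 = 0"
  proof (rule annihilator_D1)
    fix a
    show "fps_nth F 0 * a \<in> D2"
      using x[of "fps_const a"] unfolding F fls_times_fps_to_fls[symmetric]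
      by (simp add: fps_to_fls_in_series_over_iff)
  qed
  then show "x \<in> series_over {0}" unfolding F by (simp add: series_overI)
next
  fix x :: "'a fls" assume x: "x \<in> series_over {0}"
  have "x * y \<in> series_over (D1 \<inter> D2)" if "y \<in> range fps_to_fls" for y
    using x that unfolding series_over_UNIV[symmetric]
    by (rule series_over_mult) (use subring_closed(1)[OF subring_D(3)] in auto)
  then show "x \<in> frac_inv (series_over (D1 \<inter> D2)) (range fps_to_fls)"
    by (auto simp: frac_inv_def bezout_quot_field[OF bezout_R] mem_elt_times_iff)
qed

lemma fractional_ideal_A:
  "nonzero_fractional_ideal (series_over (D1 \<inter> D2)) (fls_X *o series_over D1)"
proof -
  let ?R = "series_over (D1 \<inter> D2)" and ?A = "fls_X *o series_over D1"
  have S: "subring_of_field (series_over D1)" by (rule subring_series_over[OF subring_D(1)])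
  have "?R \<subseteq> series_over D1" by (rule series_over_mono) simp
  then have "submodule_of_field ?R ?A"
    using submodule_principal[OF S, of fls_X] unfolding submodule_of_field_def by blast
  moreover have "?A \<subseteq> fls_X *o range fps_to_fls"
    by (rule set_times_mono) (auto simp: series_over_def)
  then have "1 *o ?A \<subseteq> ?R"
    unfolding X_times_series
    using series_over_mono[of "{0}" "D1 \<inter> D2"] subring_closed(1)[OF subring_D(3)] by auto
  moreover have "1 \<in> ?R" by (rule subring_closed(2)[OF subring_series_over[OF subring_D(3)]])
  moreover have "fls_X * 1 \<in> ?A" using subring_closed(2)[OF S] by (rule set_times_intro2)
  then have "?A \<noteq> {0}" by auto
  ultimately show ?thesis
    unfolding nonzero_fractional_ideal_def fractional_ideal_def bezout_quot_field[OF bezout_R]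
    by (intro conjI bexI[of _ 1]) auto
qed

text \<open>\<open>Z / t1\<close> lies in \<open>M\<close>, but not in \<open>Z R\<close>.\<close>

lemma X_times_R_psubset: "fls_X *o series_over (D1 \<inter> D2) \<subset> (series_over {0} :: 'a fls set)"
proof -
  have "inverse t1 \<notin> D1" using dvr(1) by (simp add: dvr_in_field_def)
  then have "fls_const (inverse t1) \<notin> series_over (D1 \<inter> D2)"
    using fps_to_fls_in_series_over_iff[of "fps_const (inverse t1)" "D1 \<inter> D2"] by simp
  then have "fls_X * fls_const (inverse t1) \<notin> fls_X *o series_over (D1 \<inter> D2)"
    by (auto simp: mem_elt_times_iff)
  moreover have "fls_const (inverse t1) \<in> range fps_to_fls"
    by (metis fps_const_to_fls rangeI)
  then have "fls_X * fls_const (inverse t1) \<in> fls_X *o range fps_to_fls"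
    by (rule set_times_intro2)
  moreover have "fls_X *o series_over (D1 \<inter> D2) \<subseteq> fls_X *o range fps_to_fls"
    by (rule set_times_mono) (auto simp: series_over_def)
  ultimately show ?thesis unfolding X_times_series by (metis psubsetI)
qed

end

theorem mainTheorem3:
  fixes D1 D2 D :: "'k::field rat_fun2 set"
    and V M R A B :: "'k rat_fun2 fls set"
  assumes D1: "D1 = local_poly_ring indet_X indet_Y"
    and D2: "D2 = local_poly_ring indet_Y indet_X"
    and D: "D = D1 \<inter> D2"
    and V: "V = range fps_to_fls"
    and M: "M = fls_X *o V"
    and R: "R = fls_const ` D + M"
    and A: "A = fls_X *o (fls_const ` D1 + M)"
    and B: "B = fls_X *o (fls_const ` D2 + M)"
  shows "V = range fls_const + M \<and> (\<forall>I. maximal_ideal_of V I \<longleftrightarrow> I = M)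
    \<and> pruefer_domain R
    \<and> nonzero_fractional_ideal R A \<and> nonzero_fractional_ideal R B
    \<and> frac_inv R A = V \<and> frac_inv R B = V
    \<and> v_op R A = M \<and> v_op R B = M \<and> v_op R A \<inter> v_op R B = M
    \<and> A \<inter> B = fls_X *o R
    \<and> v_op R (A \<inter> B) = fls_X *o R
    \<and> fls_X *o R \<subset> M
    \<and> \<not> stable_op R (v_op R)"
proof -
  have dvr: "dvr_in_field D1 indet_Y" "dvr_in_field D2 indet_X"
    and indep: "inverse indet_Y \<in> D2" "inverse indet_X \<in> D1"
    unfolding D1 D2 by (rule dvr_X_Y dvr_Y_X)+
  have M': "M = series_over {0}"
    unfolding M V by (rule X_times_series)
  have R': "R = series_over (D1 \<inter> D2)" "R = series_over (D2 \<inter> D1)"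
    unfolding R M' D by (simp_all add: const_plus_series Int_commute)
  have A': "A = fls_X *o series_over D1" and B': "B = fls_X *o series_over D2"
    unfolding A B M' by (simp_all add: const_plus_series)
  note swap = dvr(2,1) indep(2,1)
  have subR: "subring_of_field R"
    unfolding R'(1) using subring_series_over subring_D(3)[OF dvr indep] .
  have bez: "bezout_in_field R"
    unfolding R'(1) using bezout_R[OF dvr indep] .
  have 1: "V = range fls_const + M"
    unfolding V M' series_over_UNIV[symmetric] by (rule const_plus_series[symmetric])
  have 2: "\<forall>I. maximal_ideal_of V I \<longleftrightarrow> I = M"
    unfolding V M' using maximal_ideal_power_series by blast
  have 3: "pruefer_domain R"
    using bezout_pruefer[OF subR bez] .
  have 4: "nonzero_fractional_ideal R A" "nonzero_fractional_ideal R B"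
    using fractional_ideal_A[OF dvr indep] fractional_ideal_A[OF swap] A' B' R' by metis+
  have 5: "frac_inv R A = V" "frac_inv R B = V"
    using frac_inv_A[OF dvr indep] frac_inv_A[OF swap] A' B' R' V by metis+
  have "frac_inv R V = M"
    unfolding R'(1) V M' using frac_inv_V[OF dvr indep] .
  then have 6: "v_op R A = M" "v_op R B = M"
    by (simp_all add: v_op_def 5)
  have 7: "A \<inter> B = fls_X *o R"
    unfolding A' B' R'(1) by (simp add: elt_times_Int series_over_Int)
  have 8: "v_op R (A \<inter> B) = fls_X *o R"
    unfolding 7 using subR bezout_quot_field[OF bez] by (rule v_op_principal) simp
  have 9: "fls_X *o R \<subset> M"
    unfolding R'(1) M' using X_times_R_psubset[OF dvr indep] .
  have "\<not> stable_op R (v_op R)"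
    using 4 6 8 9 unfolding stable_op_def by blast
  with 1 2 3 4 5 6 7 8 9 show ?thesis by simp
qed

end
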